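(* Let $\Lambda$ be a finite distributive lattice, $\mathcal{A}_\Lambda$ the class of all finite $\Lambda$-ultrametric spaces, and $\vec{\mathcal{A}}_\Lambda$ a well-equipped lift of $\mathcal{A}_\Lambda$. Then $\vec{\mathcal{A}}_\Lambda$ is a Ramsey class.
   Context: For a finite lattice $\Lambda$ with bottom $\mathbb{0}$ and top $\mathbb{1}$, a $\Lambda$-ultrametric space is a set $X$ with $d:X\times X\to\Lambda$ such that $d(x,y)=\mathbb{0}$ iff $x=y$, $d$ is symmetric, and $d(x,z)\le d(x,y)\vee d(y,z)$. Each $\lambda\in\Lambda$ is identified with the equivalence relation $\{(x,y):d(x,y)\le\lambda\}$. Subquotient order: for equivalence relations $E\le F$ on $X$, a subquotient order with bottom relation $E$ and top relation $F$ is a partial order on $X/E$ in which two $E$-classes are comparable iff they lie in the same $F$-class; it is regarded as a binary relation on $X$ via $x<y$ iff $x/E<y/E$. $E\in\Lambda$ is meet-irreducible if $E\ne\mathbb{1}$ and $E=a\wedge b$ implies $E\in\{a,b\}$. Let $L$ be a language consisting of a binary relation for each distance in $\Lambda$ together with finitely many binary symbols for subquotient orders, each labelled with a bottom relation $E\in\Lambda$ and a top relation $F\in\Lambda$, $E\le F$. $L$ is $\Lambda$-well-equipped if for every $E\in\Lambda$: $E$ is the bottom relation of some subquotient-order symbol of $L$ whose top relation is different from $E$ iff $E$ is meet-irreducible. A well-equipped lift of $\mathcal{A}_\Lambda$ is, for a $\Lambda$-well-equipped $L$, the class of all finite $\Lambda$-ultrametric spaces equipped, for each subquotient-order symbol of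 $L$, with a subquotient order having the prescribed bottom and top relations. A class $\mathcal{K}$ of finite structures closed under isomorphism is a Ramsey class if for all $A,B\in\mathcal{K}$ and $k\in\mathbb{N}$ there is $C\in\mathcal{K}$ such that every $k$-colouring of the set $\binom{C}{A}$ of substructures of $C$ isomorphic to $A$ admits a substructure $\widehat B\subseteq C$ isomorphic to $B$ with $\binom{\widehat B}{A}$ monochromatic. *)

theory Defs
  imports Main "HOL-Library.Infinite_Typeclass" "HOL-Library.FuncSet"
begin

section \<open>Ramsey classes of structures in a binary relational language\<close>

record ('a, 'r) struct =
  univ :: "'a set"
  interp :: "'r \<Rightarrow> ('a \<times> 'a) set"

definition is_struct :: "('a, 'r) struct \<Rightarrow> bool" where
  "is_struct M \<longleftrightarrow> (\<forall>r. interp M r \<subseteq> univ M \<times> univ M)"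

definition struct_iso :: "('a \<Rightarrow> 'b) \<Rightarrow> ('a, 'r) struct \<Rightarrow> ('b, 'r) struct \<Rightarrow> bool" where
  "struct_iso f M N \<longleftrightarrow> bij_betw f (univ M) (univ N) \<and>
     (\<forall>r. \<forall>x\<in>univ M. \<forall>y\<in>univ M. (x, y) \<in> interp M r \<longleftrightarrow> (f x, f y) \<in> interp N r)"

definition isomorphic :: "('a, 'r) struct \<Rightarrow> ('b, 'r) struct \<Rightarrow> bool" where
  "isomorphic M N \<longleftrightarrow> (\<exists>f. struct_iso f M N)"

definition substruct :: "('a, 'r) struct \<Rightarrow> ('a, 'r) struct \<Rightarrow> bool" where
  "substruct N M \<longleftrightarrow> univ N \<subseteq> univ M \<and>
     (\<forall>r. interp N r = interp M r \<inter> (univ N \<times> univ N))"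

definition copies :: "('a, 'r) struct \<Rightarrow> ('a, 'r) struct \<Rightarrow> ('a, 'r) struct set" where
  "copies C A = {A'. substruct A' C \<and> isomorphic A' A}"

text \<open>A class of structures is represented by its members whose universe is a subset of one
  fixed type. When that type is infinite, every finite structure has an isomorphic copy there,
  so a class of finite structures closed under isomorphism is determined by these members.\<close>

definition ramsey_class :: "('a::infinite, 'r) struct set \<Rightarrow> bool" where
  "ramsey_class K \<longleftrightarrow>
     (\<forall>A\<in>K. is_struct A \<and> finite (univ A)) \<and>
     (\<forall>A\<in>K. \<forall>B. is_struct B \<and> isomorphic A B \<longrightarrow> B \<in> K) \<and>
     (\<forall>A\<in>K. \<forall>B\<in>K. \<forall>k::nat. \<exists>C\<in>K. \<forall>\<chi> \<in> copies C A \<rightarrow> {..<k}.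
        \<exists>B'\<in>copies C B. \<exists>c. \<forall>A'\<in>copies B' A. \<chi> A' = c)"

section \<open>Ultrametric spaces and subquotient orders\<close>

definition ultrametric :: "'a set \<Rightarrow> ('a \<Rightarrow> 'a \<Rightarrow> 'l::bounded_lattice) \<Rightarrow> bool" where
  "ultrametric X d \<longleftrightarrow>
     (\<forall>x\<in>X. \<forall>y\<in>X. d x y = bot \<longleftrightarrow> x = y) \<and>
     (\<forall>x\<in>X. \<forall>y\<in>X. d x y = d y x) \<and>
     (\<forall>x\<in>X. \<forall>y\<in>X. \<forall>z\<in>X. d x z \<le> sup (d x y) (d y z))"

definition dist_rel :: "'a set \<Rightarrow> ('a \<Rightarrow> 'a \<Rightarrow> 'l::bounded_lattice) \<Rightarrow> 'l \<Rightarrow> ('a \<times> 'a) set" where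
  "dist_rel X d l = {(x, y) \<in> X \<times> X. d x y \<le> l}"

text \<open>\<open>Q\<close> below is a reflexive partial order on the set of \<open>E\<close>-classes; the
  associated relation \<open>R\<close> on \<open>X\<close> is its strict part, pulled back to \<open>X\<close>.\<close>

definition subquotient_poset ::
    "'a set \<Rightarrow> ('a \<times> 'a) set \<Rightarrow> ('a \<times> 'a) set \<Rightarrow> ('a set \<times> 'a set) set \<Rightarrow> bool" where
  "subquotient_poset X E F Q \<longleftrightarrow>
     partial_order_on (X // E) Q \<and>
     (\<forall>a\<in>X // E. \<forall>b\<in>X // E.
        (a, b) \<in> Q \<or> (b, a) \<in> Q \<longleftrightarrow> (\<exists>c\<in>X // F. a \<subseteq> c \<and> b \<subseteq> c))"

definition subquotient_order ::
    "'a set \<Rightarrow> ('a \<times> 'a) set \<Rightarrow> ('a \<times> 'a) set \<Rightarrow> ('a \<times> 'a) set \<Rightarrow> bool" where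
  "subquotient_order X E F R \<longleftrightarrow>
     (\<exists>Q. subquotient_poset X E F Q \<and>
        R = {(x, y) \<in> X \<times> X. (E `` {x}, E `` {y}) \<in> Q \<and> E `` {x} \<noteq> E `` {y}})"

section \<open>Well-equipped lifts\<close>

definition meet_irreducible :: "'l::bounded_lattice \<Rightarrow> bool" where
  "meet_irreducible E \<longleftrightarrow> E \<noteq> top \<and> (\<forall>a b. E = inf a b \<longrightarrow> E \<in> {a, b})"

record ('l, 's) language =
  order_syms :: "'s set"
  bot_rel :: "'s \<Rightarrow> 'l"
  top_rel :: "'s \<Rightarrow> 'l"

datatype ('l, 's) symbol = Dist 'l | Ord 's

definition is_language :: "('l::bounded_lattice, 's) language \<Rightarrow> bool" where
  "is_language L \<longleftrightarrow> finite (order_syms L) \<and> (\<forall>s\<in>order_syms L. bot_rel L s \<le> top_rel L s)"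

definition well_equipped :: "('l::bounded_lattice, 's) language \<Rightarrow> bool" where
  "well_equipped L \<longleftrightarrow> is_language L \<and>
     (\<forall>E. (\<exists>s\<in>order_syms L. bot_rel L s = E \<and> top_rel L s \<noteq> E) \<longleftrightarrow> meet_irreducible E)"

text \<open>The symbol \<open>Dist l\<close> is interpreted as the set of pairs at distance exactly \<open>l\<close>.
  Elements of the type \<open>'s\<close> outside \<open>order_syms L\<close> are not symbols of \<open>L\<close>; they
  are interpreted as empty so that structures for \<open>L\<close> have no further content.\<close>

definition lift :: "('l::bounded_lattice, 's) language \<Rightarrow> ('a, ('l, 's) symbol) struct set" where
  "lift L = {M. is_struct M \<and> finite (univ M) \<and>
     (\<exists>d. ultrametric (univ M) d \<and>
        (\<forall>l. interp M (Dist l) = {(x, y) \<in> univ M \<times> univ M. d x y = l}) \<and>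
        (\<forall>s\<in>order_syms L. subquotient_order (univ M)
           (dist_rel (univ M) d (bot_rel L s)) (dist_rel (univ M) d (top_rel L s))
           (interp M (Ord s)))) \<and>
     (\<forall>s. s \<notin> order_syms L \<longrightarrow> interp M (Ord s) = {})}"

end

theory Submission
  imports Defs "HOL-Library.Ramsey"
begin

text \<open>Only symbols \<open>s\<close> whose bottom and top relations differ carry an order. Extend the order \<open>s\<close>
  definably to a linear order of all \<open>bot_rel L s\<close>-classes and number these classes increasingly,
  using disjoint blocks of natural numbers for different symbols. A point is determined by
  its numbers, since every meet-irreducible is some \<open>bot_rel L s\<close>. Conversely, functions from
  the symbols to \<open>{..<N}\<close> form a member of the lift when \<open>x\<close> and \<open>y\<close> are related by \<open>F\<close> iff they
  agree at every \<open>s\<close> with \<open>F \<le> bot_rel L s\<close> and the order \<open>s\<close> compares first the \<open>s\<close>-th coordinate.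
  A member \<open>A\<close> embeds there along any set of labels of the right size \<open>n\<close>, and this
  set determines the copy; hence Ramsey's theorem for \<open>n\<close>-element subsets suffices.\<close>

section \<open>Numerical representations of strict weak orders\<close>

text \<open>The equivalence makes \<open>P\<close>-incomparable elements share a number, so
  \<open>\<rho>\<close> numbers the incomparability classes increasingly. The values need not be an
  initial segment, so labels may be drawn from any set of the right size.\<close>

definition represents :: "'w set \<Rightarrow> ('w \<Rightarrow> 'w \<Rightarrow> bool) \<Rightarrow> ('w \<Rightarrow> nat) \<Rightarrow> bool" where
  "represents W P \<rho> \<longleftrightarrow> (\<forall>v\<in>W. \<forall>w\<in>W. \<rho> v < \<rho> w \<longleftrightarrow> P v w)"

text \<open>Number each element by how many elements precede it. If \<open>P v w\<close> holds,
  irreflexivity and transitivity make the predecessors of \<open>v\<close> a proper subset of those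
  of \<open>w\<close>; if it fails, negative transitivity puts the predecessors of \<open>w\<close>
  among those of \<open>v\<close>.\<close>

lemma represents_exists:
  assumes fin: "finite W"
    and irrefl: "\<And>v. v \<in> W \<Longrightarrow> \<not> P v v"
    and trans: "\<And>u v w. \<lbrakk>u \<in> W; v \<in> W; w \<in> W; P u v; P v w\<rbrakk> \<Longrightarrow> P u w"
    and negtrans: "\<And>u v w. \<lbrakk>u \<in> W; v \<in> W; w \<in> W; P u w\<rbrakk> \<Longrightarrow> P u v \<or> P v w"
  shows "\<exists>\<rho>. represents W P \<rho>"
proof -
  have "card {u \<in> W. P u v} < card {u \<in> W. P u w} \<longleftrightarrow> P v w" if "v \<in> W" "w \<in> W" for v w
  proof
    assume "P v w"
    then have "{u \<in> W. P u v} \<subset> {u \<in> W. P u w}"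
      using that irrefl trans by blast
    then show "card {u \<in> W. P u v} < card {u \<in> W. P u w}"
      using fin by (simp add: psubset_card_mono)
  next
    assume less: "card {u \<in> W. P u v} < card {u \<in> W. P u w}"
    show "P v w"
    proof (rule ccontr)
      assume "\<not> P v w"
      then have "{u \<in> W. P u w} \<subseteq> {u \<in> W. P u v}"
        using that negtrans by blast
      then show False
        using less fin by (simp add: card_mono leD)
    qed
  qed
  then show ?thesis
    unfolding represents_def by (intro exI[of _ "\<lambda>v. card {u \<in> W. P u v}"]) simp
qed

lemma represents_eq_iff:
  assumes "represents W P \<rho>" "represents W P \<sigma>" "v \<in> W" "w \<in> W"
  shows "\<rho> v = \<rho> w \<longleftrightarrow> \<sigma> v = \<sigma> w"
proof -
  have "\<rho> v < \<rho> w \<longleftrightarrow> \<sigma> v < \<sigma> w" "\<rho> w < \<rho> v \<longleftrightarrow> \<sigma> w < \<sigma> v"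
    using assms by (simp_all add: represents_def)
  then show ?thesis by linarith
qed

text \<open>Both images are in bijection with the classes of the common kernel.\<close>

lemma card_image_same_kernel:
  assumes "\<And>v w. \<lbrakk>v \<in> V; w \<in> V\<rbrakk> \<Longrightarrow> \<rho> v = \<rho> w \<longleftrightarrow> \<sigma> v = \<sigma> w"
  shows "card (\<rho> ` V) = card (\<sigma> ` V)"
proof -
  have "bij_betw (\<sigma> \<circ> inv_into V \<rho>) (\<rho> ` V) (\<sigma> ` V)"
    unfolding bij_betw_def
  proof
    show "inj_on (\<sigma> \<circ> inv_into V \<rho>) (\<rho> ` V)"
      by (rule inj_onI) (metis assms comp_apply f_inv_into_f inv_into_into)
    have "\<sigma> (inv_into V \<rho> (\<rho> v)) = \<sigma> v" if "v \<in> V" for v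
      using that by (metis assms f_inv_into_f imageI inv_into_into)
    then show "(\<sigma> \<circ> inv_into V \<rho>) ` \<rho> ` V = \<sigma> ` V"
      by (force simp: image_iff)
  qed
  then show ?thesis by (rule bij_betw_same_card)
qed

lemma represents_card:
  assumes "represents W P \<rho>" "represents W P \<sigma>"
  shows "card (\<rho> ` W) = card (\<sigma> ` W)"
  using represents_eq_iff[OF assms] by (rule card_image_same_kernel)

text \<open>How many labels lie below \<open>\<rho> w\<close> depends only on \<open>P\<close>, and
  the position of an element in the common finite image determines it. Hence a label set fixes the
  labelling.\<close>

lemma represents_unique:
  assumes \<rho>: "represents W P \<rho>" and \<sigma>: "represents W P \<sigma>" and fin: "finite W"
    and im: "\<rho> ` W = \<sigma> ` W" and w: "w \<in> W"
  shows "\<rho> w = \<sigma> w"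
proof -
  let ?V = "{v \<in> W. P v w}"
  have below: "{h \<in> \<tau> ` W. h < \<tau> w} = \<tau> ` ?V" if "represents W P \<tau>" for \<tau>
    using that w unfolding represents_def by auto
  have "card (\<rho> ` ?V) = card (\<sigma> ` ?V)"
    by (rule card_image_same_kernel) (use represents_eq_iff[OF \<rho> \<sigma>] in auto)
  then have eq: "card {h \<in> \<rho> ` W. h < \<rho> w} = card {h \<in> \<rho> ` W. h < \<sigma> w}"
    using below[OF \<rho>] below[OF \<sigma>] im by simp
  have mono: "card {h \<in> \<rho> ` W. h < a} < card {h \<in> \<rho> ` W. h < b}" if "a \<in> \<rho> ` W" "a < b" for a b
    using that fin by (intro psubset_card_mono) auto
  show ?thesis
  proof (rule linorder_cases[of "\<rho> w" "\<sigma> w"])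
    assume "\<rho> w < \<sigma> w"
    then show ?thesis using mono[of "\<rho> w" "\<sigma> w"] w eq by simp
  next
    assume "\<sigma> w < \<rho> w"
    moreover have "\<sigma> w \<in> \<rho> ` W" using w im by simp
    ultimately show ?thesis using mono[of "\<sigma> w" "\<rho> w"] eq by simp
  qed
qed

text \<open>Each label is replaced by the element of \<open>H\<close> of the same rank, passing
  through \<open>{..<card H}\<close>.\<close>

lemma represents_onto:
  assumes \<rho>: "represents W P \<rho>" and fin: "finite W" "finite H" and card: "card H = card (\<rho> ` W)"
  shows "\<exists>\<sigma>. represents W P \<sigma> \<and> \<sigma> ` W = H"
proof -
  obtain f where f: "bij_betw f {..<card H} H" "strict_mono_on {..<card H} f"
    using ex_bij_betw_strict_mono_card[OF fin(2)] .
  obtain g where g: "bij_betw g {..<card H} (\<rho> ` W)" "strict_mono_on {..<card H} g"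
    using ex_bij_betw_strict_mono_card[of "\<rho> ` W"] fin(1) card by auto
  define g' where "g' = inv_into {..<card H} g"
  have g': "bij_betw g' (\<rho> ` W) {..<card H}"
    unfolding g'_def using g(1) by (rule bij_betw_inv_into)
  have gg': "g (g' (\<rho> v)) = \<rho> v" "g' (\<rho> v) \<in> {..<card H}" if "v \<in> W" for v
    using that g(1) g' unfolding g'_def
    by (auto simp: bij_betw_inv_into_right dest: bij_betwE)
  have "f (g' (\<rho> v)) < f (g' (\<rho> w)) \<longleftrightarrow> \<rho> v < \<rho> w" if "v \<in> W" "w \<in> W" for v w
    using gg'[OF that(1)] gg'[OF that(2)] strict_mono_on_less[OF f(2)] strict_mono_on_less[OF g(2)]
    by metis
  then have "represents W P (f \<circ> g' \<circ> \<rho>)"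
    using \<rho> unfolding represents_def by simp
  moreover have "(f \<circ> g' \<circ> \<rho>) ` W = H"
    using f(1) g' by (metis bij_betw_imp_surj_on image_comp)
  ultimately show ?thesis by blast
qed

section \<open>Meet-irreducible elements\<close>

text \<open>An element maximal among those above \<open>u\<close> but not above \<open>l\<close> is
  meet-irreducible: if it were the meet of two strictly larger elements, both would lie above
  \<open>l\<close>, and so would their meet.\<close>

lemma le_iff_meet_irreducibles:
  fixes l u :: "'l::{finite, bounded_lattice}"
  shows "l \<le> u \<longleftrightarrow> (\<forall>m. meet_irreducible m \<longrightarrow> u \<le> m \<longrightarrow> l \<le> m)"
proof
  assume "\<forall>m. meet_irreducible m \<longrightarrow> u \<le> m \<longrightarrow> l \<le> m"
  show "l \<le> u"
  proof (rule ccontr)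
    assume "\<not> l \<le> u"
    define T where "T = {m. u \<le> m \<and> \<not> l \<le> m}"
    have "finite T" "T \<noteq> {}" using \<open>\<not> l \<le> u\<close> by (auto simp: T_def)
    then obtain m where m: "m \<in> T" and max: "\<forall>b\<in>T. m \<le> b \<longrightarrow> m = b"
      using finite_has_maximal by blast
    have "meet_irreducible m"
      unfolding meet_irreducible_def
    proof (intro conjI allI impI)
      show "m \<noteq> top" using m by (auto simp: T_def)
      fix a b assume eq: "m = inf a b"
      then have "m \<le> a" "m \<le> b" by auto
      show "m \<in> {a, b}"
      proof (rule ccontr)
        assume "m \<notin> {a, b}"
        then have "a \<notin> T" "b \<notin> T" using max \<open>m \<le> a\<close> \<open>m \<le> b\<close> by auto
        then have "l \<le> a" "l \<le> b"
          using m \<open>m \<le> a\<close> \<open>m \<le> b\<close> by (auto simp: T_def intro: order_trans)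
        then show False using m eq by (auto simp: T_def)
      qed
    qed
    then show False
      using m \<open>\<forall>m. _ m \<longrightarrow> _ m \<longrightarrow> _ m\<close> by (auto simp: T_def)
  qed
qed (auto intro: order_trans)

text \<open>Distributivity turns \<open>m = sup (inf a b) m\<close> into a meet of
  \<open>sup a m\<close> and \<open>sup b m\<close>, one of which must then be
  \<open>m\<close>.\<close>

lemma meet_irreducible_prime:
  fixes m :: "'l::{distrib_lattice, bounded_lattice}"
  assumes "meet_irreducible m"
  shows "inf a b \<le> m \<longleftrightarrow> a \<le> m \<or> b \<le> m"
proof
  assume "inf a b \<le> m"
  then have "m = inf (sup a m) (sup b m)"
    by (metis sup_absorb2 sup_inf_distrib2)
  then have "m = sup a m \<or> m = sup b m"
    using assms unfolding meet_irreducible_def by blast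
  then show "a \<le> m \<or> b \<le> m"
    by (metis sup_ge1)
qed (auto intro: le_infI1 le_infI2)

text \<open>The witness is the meet of \<open>T\<close>, and primeness carries the induction. This
  later yields a distance with prescribed meet-irreducibles above it.\<close>

lemma meet_of_finite_set:
  fixes T :: "'l::{distrib_lattice, bounded_lattice} set"
  assumes "finite T"
  shows "\<exists>l. \<forall>m. meet_irreducible m \<longrightarrow> (l \<le> m \<longleftrightarrow> (\<exists>a\<in>T. a \<le> m))"
  using assms
proof induction
  case empty
  \<comment> \<open>The empty meet is \<open>top\<close>, which lies below no meet-irreducible
    because these differ from \<open>top\<close>.\<close>
  then show ?case
    by (intro exI[of _ top]) (auto simp: meet_irreducible_def top_unique)
next
  case (insert a T)
  then obtain l where "\<forall>m. meet_irreducible m \<longrightarrow> (l \<le> m \<longleftrightarrow> (\<exists>a\<in>T. a \<le> m))" by blast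
  then show ?case
    by (intro exI[of _ "inf a l"]) (auto simp: meet_irreducible_prime)
qed

section \<open>Subquotient orders as relations on points\<close>

text \<open>Replaces orders on classes by conditions on points. Invariance of \<open>R\<close> under
  \<open>E\<close> follows from trichotomy, transitivity and disjointness from
  \<open>E\<close>.\<close>

lemma subquotient_order_iff:
  assumes E: "equiv X E" and F: "equiv X F" and EF: "E \<subseteq> F"
  shows "subquotient_order X E F R \<longleftrightarrow>
    R \<subseteq> X \<times> X \<and> trans R \<and> R \<inter> E = {} \<and>
    (\<forall>x\<in>X. \<forall>y\<in>X. (x, y) \<in> F \<longleftrightarrow> (x, y) \<in> E \<or> (x, y) \<in> R \<or> (y, x) \<in> R)"
    (is "_ \<longleftrightarrow> ?rhs")
proof -
  have cls: "E `` {x} = E `` {y} \<longleftrightarrow> (x, y) \<in> E" if "x \<in> X" "y \<in> X" for x y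
    using eq_equiv_class_iff[OF E that] .
  have both: "(\<exists>c\<in>X // F. E `` {x} \<subseteq> c \<and> E `` {y} \<subseteq> c) \<longleftrightarrow> (x, y) \<in> F"
    if xy: "x \<in> X" "y \<in> X" for x y
  proof
    assume "\<exists>c\<in>X // F. E `` {x} \<subseteq> c \<and> E `` {y} \<subseteq> c"
    then obtain c where c: "c \<in> X // F" "E `` {x} \<subseteq> c" "E `` {y} \<subseteq> c" by blast
    have "x \<in> c" "y \<in> c" using c xy equiv_class_self[OF E] by auto
    then show "(x, y) \<in> F" using c(1) quotient_eq_iff[OF F] by blast
  next
    assume "(x, y) \<in> F"
    then have "E `` {x} \<subseteq> F `` {x}" "E `` {y} \<subseteq> F `` {x}"
      using EF equiv_class_eq[OF F] by auto
    then show "\<exists>c\<in>X // F. E `` {x} \<subseteq> c \<and> E `` {y} \<subseteq> c"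
      using quotientI[OF xy(1), of F] by blast
  qed
  have quot: "X // E = (\<lambda>x. E `` {x}) ` X" by (auto simp: quotient_def)
  show ?thesis
  proof
    assume "subquotient_order X E F R"
    then obtain Q where Q: "subquotient_poset X E F Q"
      and R: "R = {(x, y) \<in> X \<times> X. (E `` {x}, E `` {y}) \<in> Q \<and> E `` {x} \<noteq> E `` {y}}"
      unfolding subquotient_order_def by blast
    have po: "refl_on (X // E) Q" "trans Q" "antisym Q"
      using Q unfolding subquotient_poset_def partial_order_on_def preorder_on_def by auto
    have comp: "(E `` {x}, E `` {y}) \<in> Q \<or> (E `` {y}, E `` {x}) \<in> Q \<longleftrightarrow> (x, y) \<in> F"
      if "x \<in> X" "y \<in> X" for x y
      using Q both[OF that] that unfolding subquotient_poset_def by (simp add: quotientI)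
    have "trans R"
      unfolding R using po(2,3) by (auto intro!: transI dest: transD antisymD)
    moreover have "R \<inter> E = {}" unfolding R using cls by auto
    moreover have "(x, y) \<in> F \<longleftrightarrow> (x, y) \<in> E \<or> (x, y) \<in> R \<or> (y, x) \<in> R" if "x \<in> X" "y \<in> X" for x y
      using comp[OF that] cls[OF that] that EF unfolding R by auto
    moreover have "R \<subseteq> X \<times> X" unfolding R by blast
    ultimately show ?rhs by simp
  next
    assume r: ?rhs
    have sub: "R \<subseteq> X \<times> X" and tr: "\<And>x y z. (x, y) \<in> R \<Longrightarrow> (y, z) \<in> R \<Longrightarrow> (x, z) \<in> R"
      and disj: "\<And>x y. (x, y) \<in> R \<Longrightarrow> (x, y) \<notin> E"
      and tri: "\<And>x y. x \<in> X \<Longrightarrow> y \<in> X \<Longrightarrow> (x, y) \<in> F \<longleftrightarrow> (x, y) \<in> E \<or> (x, y) \<in> R \<or> (y, x) \<in> R"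
      using r by (auto dest: transD)
    have symE: "(x, y) \<in> E \<Longrightarrow> (y, x) \<in> E" for x y using E by (meson equivE symD)
    have transE: "(x, y) \<in> E \<Longrightarrow> (y, z) \<in> E \<Longrightarrow> (x, z) \<in> E" for x y z using E by (meson equivE transD)
    have transF: "(x, y) \<in> F \<Longrightarrow> (y, z) \<in> F \<Longrightarrow> (x, z) \<in> F" for x y z using F by (meson equivE transD)
    have EX: "(x, y) \<in> E \<Longrightarrow> x \<in> X \<and> y \<in> X" for x y using E by (auto simp: equiv_def)
    have RX: "(x, y) \<in> R \<Longrightarrow> x \<in> X \<and> y \<in> X" for x y using sub by auto
    have RF: "(x, y) \<in> R \<Longrightarrow> (x, y) \<in> F" for x y using tri RX by blast
    \<comment> \<open>Trichotomy applies inside the common \<open>F\<close>-class: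
      \<open>(x', y) \<in> E\<close> would give \<open>(x, y) \<in> E\<close>, and
      \<open>(y, x') \<in> R\<close> would give \<open>(x, x') \<in> R\<close>, both against
      disjointness.\<close>
    have invl: "(x', y) \<in> R" if "(x', x) \<in> E" "(x, y) \<in> R" for x x' y
    proof -
      have "(x', y) \<in> F" using that EF RF transF by blast
      then have "(x', y) \<in> E \<or> (x', y) \<in> R \<or> (y, x') \<in> R" using tri EX RX that by blast
      then show ?thesis using that symE transE tr disj by blast
    qed
    have invr: "(y, x') \<in> R" if "(x', x) \<in> E" "(y, x) \<in> R" for x x' y
    proof -
      have "(y, x') \<in> F" using that EF RF transF symE by blast
      then have "(y, x') \<in> E \<or> (y, x') \<in> R \<or> (x', y) \<in> R" using tri EX RX that by blast
      then show ?thesis using that symE transE tr disj by blast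
    qed
    \<comment> \<open>Reflexivity of \<open>Q\<close> calls for the pairs of \<open>E\<close> as
      well; \<open>invl\<close> and \<open>invr\<close> make membership independent of the
      representatives.\<close>
    define Q where "Q = {(E `` {x}, E `` {y}) |x y. x \<in> X \<and> y \<in> X \<and> (x, y) \<in> E \<union> R}"
    have Q_iff: "(E `` {x}, E `` {y}) \<in> Q \<longleftrightarrow> (x, y) \<in> E \<union> R" if xy: "x \<in> X" "y \<in> X" for x y
    proof
      assume "(E `` {x}, E `` {y}) \<in> Q"
      then obtain x' y' where "x' \<in> X" "y' \<in> X" "(x', y') \<in> E \<union> R"
        "E `` {x} = E `` {x'}" "E `` {y} = E `` {y'}"
        unfolding Q_def by blast
      then show "(x, y) \<in> E \<union> R"
        using cls xy invl invr transE symE by (metis Un_iff)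
    qed (use xy in \<open>auto simp: Q_def\<close>)
    have Q_sub: "Q \<subseteq> (X // E) \<times> (X // E)" unfolding Q_def quot by auto
    have reflQ: "refl_on (X // E) Q"
      unfolding refl_on_def quot using Q_iff E by (auto simp: equiv_def refl_on_def)
    have transQ: "trans Q"
    proof (rule transI)
      fix a b c assume ab: "(a, b) \<in> Q" and bc: "(b, c) \<in> Q"
      then obtain x y z where xyz: "x \<in> X" "y \<in> X" "z \<in> X" "a = E `` {x}" "b = E `` {y}" "c = E `` {z}"
        using Q_sub unfolding quot by blast
      then have "(x, y) \<in> E \<union> R" "(y, z) \<in> E \<union> R" using ab bc Q_iff by auto
      then have "(x, z) \<in> E \<union> R" using transE tr invl invr symE by blast
      then show "(a, c) \<in> Q" using Q_iff xyz by simp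
    qed
    have antiQ: "antisym Q"
    proof (rule antisymI)
      fix a b assume ab: "(a, b) \<in> Q" and ba: "(b, a) \<in> Q"
      then obtain x y where xy: "x \<in> X" "y \<in> X" "a = E `` {x}" "b = E `` {y}"
        using Q_sub unfolding quot by blast
      then have "(x, y) \<in> E \<union> R" "(y, x) \<in> E \<union> R" using ab ba Q_iff by auto
      moreover have "(x, x) \<in> E" using xy E by (auto simp: equiv_def refl_on_def)
      ultimately have "(x, y) \<in> E" using symE tr disj by blast
      then show "a = b" using cls xy by simp
    qed
    have "subquotient_poset X E F Q"
      unfolding subquotient_poset_def partial_order_on_def preorder_on_def
      using Q_sub reflQ transQ antiQ
      by (auto simp: quot both Q_iff tri symE)
    moreover have "(x, y) \<in> R \<longleftrightarrow> x \<in> X \<and> y \<in> X \<and> (E `` {x}, E `` {y}) \<in> Q \<and> E `` {x} \<noteq> E `` {y}" for x y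
      using Q_iff[of x y] cls[of x y] disj[of x y] RX[of x y] by blast
    then have "R = {(x, y) \<in> X \<times> X. (E `` {x}, E `` {y}) \<in> Q \<and> E `` {x} \<noteq> E `` {y}}"
      by (intro equalityI subrelI) simp_all
    ultimately show "subquotient_order X E F R"
      unfolding subquotient_order_def by blast
  qed
qed

section \<open>Embeddings and copies\<close>

definition restr :: "('a, 'r) struct \<Rightarrow> 'a set \<Rightarrow> ('a, 'r) struct" where
  "restr M U = \<lparr>univ = U, interp = \<lambda>r. interp M r \<inter> U \<times> U\<rparr>"

definition embedding :: "('a \<Rightarrow> 'b) \<Rightarrow> ('a, 'r) struct \<Rightarrow> ('b, 'r) struct \<Rightarrow> bool" where
  "embedding g A C \<longleftrightarrow> inj_on g (univ A) \<and> g ` univ A \<subseteq> univ C \<and>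
     (\<forall>r. \<forall>x\<in>univ A. \<forall>y\<in>univ A. (x, y) \<in> interp A r \<longleftrightarrow> (g x, g y) \<in> interp C r)"

lemma struct_iso_inverse:
  assumes "struct_iso f M N"
  shows "struct_iso (inv_into (univ M) f) N M"
proof -
  have bij: "bij_betw f (univ M) (univ N)" using assms by (simp add: struct_iso_def)
  let ?g = "inv_into (univ M) f"
  have g: "?g x \<in> univ M" "f (?g x) = x" if "x \<in> univ N" for x
    using that bij_betw_inv_into_right[OF bij] bij_betwE[OF bij_betw_inv_into[OF bij]] by auto
  have "(x, y) \<in> interp N r \<longleftrightarrow> (?g x, ?g y) \<in> interp M r" if "x \<in> univ N" "y \<in> univ N" for r x y
    using assms g[OF that(1)] g[OF that(2)] unfolding struct_iso_def by metis
  then show ?thesis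
    unfolding struct_iso_def using bij_betw_inv_into[OF bij] by blast
qed

text \<open>A substructure is fixed by its universe, and inverting an isomorphism onto
  \<open>A\<close> gives an embedding of \<open>A\<close>.\<close>

lemma copies_eq_embeddings:
  "copies C A = {restr C (g ` univ A) |g. embedding g A C}"
proof (intro equalityI subsetI)
  fix A' assume "A' \<in> copies C A"
  then obtain f where sub: "substruct A' C" and f: "struct_iso f A' A"
    by (auto simp: copies_def isomorphic_def)
  define g where "g = inv_into (univ A') f"
  have g: "struct_iso g A A'"
    unfolding g_def using f by (rule struct_iso_inverse)
  then have im: "g ` univ A = univ A'"
    by (simp add: struct_iso_def bij_betw_def)
  have mem: "g x \<in> univ A'" if "x \<in> univ A" for x
    using that im by blast
  have "embedding g A C"
    using g sub mem im unfolding embedding_def struct_iso_def substruct_def bij_betw_def by simp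
  moreover have "A' = restr C (g ` univ A)"
    using sub unfolding im restr_def substruct_def by (intro struct.equality) auto
  ultimately show "A' \<in> {restr C (g ` univ A) |g. embedding g A C}" by blast
next
  fix A' assume "A' \<in> {restr C (g ` univ A) |g. embedding g A C}"
  then obtain g where g: "embedding g A C" and A': "A' = restr C (g ` univ A)" by blast
  have "struct_iso g A A'"
    using g unfolding A' struct_iso_def embedding_def restr_def bij_betw_def by simp
  then have "isomorphic A' A"
    unfolding isomorphic_def using struct_iso_inverse by blast
  moreover have "substruct A' C"
    using g unfolding A' substruct_def embedding_def restr_def by simp
  ultimately show "A' \<in> copies C A" by (simp add: copies_def)
qed

lemma embedding_comp:
  assumes f: "embedding f A B" and g: "embedding g B C"
  shows "embedding (g \<circ> f) A C"
proof -
  have mem: "f x \<in> univ B" if "x \<in> univ A" for x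
    using that f unfolding embedding_def by blast
  have "inj_on (g \<circ> f) (univ A)"
    using f g unfolding embedding_def by (auto intro: comp_inj_on inj_on_subset)
  then show ?thesis
    using f g mem unfolding embedding_def by (auto simp: image_subset_iff)
qed

text \<open>The copy lies in the image of \<open>h\<close>, so undoing \<open>h\<close> gives an
  embedding of \<open>A\<close> into \<open>B\<close> itself.\<close>

lemma copies_of_copy:
  assumes h: "embedding h B C" and A': "A' \<in> copies (restr C (h ` univ B)) A"
  obtains f where "embedding f A B" "A' = restr C ((h \<circ> f) ` univ A)"
proof -
  obtain g where g: "embedding g A (restr C (h ` univ B))"
    and A'_eq: "A' = restr (restr C (h ` univ B)) (g ` univ A)"
    using A' unfolding copies_eq_embeddings by blast
  have sub: "g ` univ A \<subseteq> h ` univ B"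
    using g by (auto simp: embedding_def restr_def)
  define f where "f = inv_into (univ B) h \<circ> g"
  have hf: "h (f x) = g x" and fB: "f x \<in> univ B" if "x \<in> univ A" for x
    using that sub by (auto simp: f_def f_inv_into_f inv_into_into image_subset_iff)
  have "(x, y) \<in> interp A r \<longleftrightarrow> (f x, f y) \<in> interp B r" if "x \<in> univ A" "y \<in> univ A" for r x y
  proof -
    have "(x, y) \<in> interp A r \<longleftrightarrow> (g x, g y) \<in> interp C r"
      using g sub that unfolding embedding_def restr_def by auto
    also have "\<dots> \<longleftrightarrow> (f x, f y) \<in> interp B r"
      using h hf[OF that(1)] hf[OF that(2)] fB[OF that(1)] fB[OF that(2)]
      unfolding embedding_def by metis
    finally show ?thesis .
  qed
  moreover have "inj_on f (univ A)"
    using g hf unfolding embedding_def inj_on_def by metis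
  ultimately have "embedding f A B"
    using fB unfolding embedding_def by blast
  moreover have "g ` univ A = (h \<circ> f) ` univ A"
    using hf by (auto simp: image_iff)
  then have "A' = restr C ((h \<circ> f) ` univ A)"
    using sub unfolding A'_eq restr_def by (auto intro!: ext)
  ultimately show ?thesis by (rule that)
qed

section \<open>Members of a lift\<close>

text \<open>The equivalence relation identified with \<open>F\<close>, expressed by the distance
  predicates alone: no metric has to be chosen, and embeddings visibly preserve it.\<close>

definition sim :: "('a, ('l::bounded_lattice, 's) symbol) struct \<Rightarrow> 'l \<Rightarrow> 'a \<Rightarrow> 'a \<Rightarrow> bool" where
  "sim M F x y \<longleftrightarrow> (\<exists>l\<le>F. (x, y) \<in> interp M (Dist l))"

lemma equiv_dist_rel:
  assumes "ultrametric X d"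
  shows "equiv X (dist_rel X d l)"
proof (rule equivI)
  show "dist_rel X d l \<subseteq> X \<times> X" by (auto simp: dist_rel_def)
  have "d x x = bot" if "x \<in> X" for x
    using assms that by (simp add: ultrametric_def)
  then show "refl_on X (dist_rel X d l)"
    by (simp add: refl_on_def dist_rel_def)
  have "d x y = d y x" if "x \<in> X" "y \<in> X" for x y
    using assms that unfolding ultrametric_def by blast
  then show "sym (dist_rel X d l)"
    unfolding sym_def dist_rel_def by force
  have "d x z \<le> l" if "x \<in> X" "y \<in> X" "z \<in> X" "d x y \<le> l" "d y z \<le> l" for x y z
    using assms that unfolding ultrametric_def by (meson le_supI order_trans)
  then show "trans (dist_rel X d l)"
    unfolding trans_def dist_rel_def by blast
qed

lemma lift_iff:
  assumes "is_language L"
  shows "M \<in> lift L \<longleftrightarrow> is_struct M \<and> finite (univ M) \<and>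
    (\<exists>d. ultrametric (univ M) d \<and>
      (\<forall>l. interp M (Dist l) = {(x, y) \<in> univ M \<times> univ M. d x y = l}) \<and>
      (\<forall>s\<in>order_syms L. trans (interp M (Ord s)) \<and>
        (\<forall>x\<in>univ M. \<forall>y\<in>univ M. ((x, y) \<in> interp M (Ord s) \<longrightarrow> \<not> d x y \<le> bot_rel L s) \<and>
          (d x y \<le> top_rel L s \<longleftrightarrow> d x y \<le> bot_rel L s \<or>
            (x, y) \<in> interp M (Ord s) \<or> (y, x) \<in> interp M (Ord s))))) \<and>
    (\<forall>s. s \<notin> order_syms L \<longrightarrow> interp M (Ord s) = {})"
proof -
  have "subquotient_order (univ M) (dist_rel (univ M) d (bot_rel L s))
      (dist_rel (univ M) d (top_rel L s)) (interp M (Ord s)) \<longleftrightarrow>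
      trans (interp M (Ord s)) \<and>
        (\<forall>x\<in>univ M. \<forall>y\<in>univ M. ((x, y) \<in> interp M (Ord s) \<longrightarrow> \<not> d x y \<le> bot_rel L s) \<and>
          (d x y \<le> top_rel L s \<longleftrightarrow> d x y \<le> bot_rel L s \<or>
            (x, y) \<in> interp M (Ord s) \<or> (y, x) \<in> interp M (Ord s)))"
    if "is_struct M" "ultrametric (univ M) d" "s \<in> order_syms L" for d s
  proof -
    have "bot_rel L s \<le> top_rel L s"
      using assms that(3) by (simp add: is_language_def)
    then have sub: "dist_rel (univ M) d (bot_rel L s) \<subseteq> dist_rel (univ M) d (top_rel L s)"
      by (auto simp: dist_rel_def)
    have "interp M (Ord s) \<subseteq> univ M \<times> univ M"
      using that(1) by (simp add: is_struct_def)
    then show ?thesis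
      unfolding subquotient_order_iff[OF equiv_dist_rel[OF that(2)] equiv_dist_rel[OF that(2)] sub]
      by (auto simp: dist_rel_def)
  qed
  then show ?thesis
    unfolding lift_def by (simp cong: conj_cong)
qed

text \<open>The distance is pulled back along the inverse isomorphism. Besides closure under
  isomorphism, this later moves a structure on functions into the type \<open>'a\<close>.\<close>

lemma lift_struct_iso:
  assumes L: "is_language L" and M: "M \<in> lift L" and iso: "struct_iso f M N" and N: "is_struct N"
  shows "N \<in> lift L"
proof -
  define g where "g = inv_into (univ M) f"
  have g: "struct_iso g N M"
    unfolding g_def using iso by (rule struct_iso_inverse)
  then have gN: "g x \<in> univ M" if "x \<in> univ N" for x
    using that by (auto simp: struct_iso_def dest: bij_betwE)
  have inj: "g x = g y \<longleftrightarrow> x = y" if "x \<in> univ N" "y \<in> univ N" for x y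
    using g that by (auto simp: struct_iso_def bij_betw_def inj_on_def)
  have int: "(x, y) \<in> interp N r \<longleftrightarrow> x \<in> univ N \<and> y \<in> univ N \<and> (g x, g y) \<in> interp M r" for x y r
    using g N unfolding struct_iso_def is_struct_def by blast
  obtain d where d: "ultrametric (univ M) d"
    and dist: "\<And>l. interp M (Dist l) = {(x, y) \<in> univ M \<times> univ M. d x y = l}"
    and tr: "\<And>s. s \<in> order_syms L \<Longrightarrow> trans (interp M (Ord s))"
    and ord: "\<And>s x y. s \<in> order_syms L \<Longrightarrow> x \<in> univ M \<Longrightarrow> y \<in> univ M \<Longrightarrow>
        ((x, y) \<in> interp M (Ord s) \<longrightarrow> \<not> d x y \<le> bot_rel L s) \<and>
          (d x y \<le> top_rel L s \<longleftrightarrow> d x y \<le> bot_rel L s \<or>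
            (x, y) \<in> interp M (Ord s) \<or> (y, x) \<in> interp M (Ord s))"
    using M unfolding lift_iff[OF L] by blast
  define e where "e x y = d (g x) (g y)" for x y
  have "finite (univ N)"
    using M iso bij_betw_finite unfolding lift_def struct_iso_def by blast
  moreover have "ultrametric (univ N) e"
    using d gN inj unfolding ultrametric_def e_def by simp
  moreover have "interp N (Dist l) = {(x, y) \<in> univ N \<times> univ N. e x y = l}" for l
    using gN by (auto simp: int dist e_def)
  moreover have "trans (interp N (Ord s))" if "s \<in> order_syms L" for s
    using tr[OF that] unfolding trans_def int by blast
  moreover have "((x, y) \<in> interp N (Ord s) \<longrightarrow> \<not> e x y \<le> bot_rel L s) \<and>
          (e x y \<le> top_rel L s \<longleftrightarrow> e x y \<le> bot_rel L s \<or>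
            (x, y) \<in> interp N (Ord s) \<or> (y, x) \<in> interp N (Ord s))"
    if "s \<in> order_syms L" "x \<in> univ N" "y \<in> univ N" for s x y
    using ord[OF that(1) gN[OF that(2)] gN[OF that(3)]] that by (simp add: int e_def)
  moreover have "interp N (Ord s) = {}" if "s \<notin> order_syms L" for s
    using that M by (auto simp: int lift_def)
  ultimately show ?thesis
    unfolding lift_iff[OF L] using N by blast
qed

section \<open>Canonical extensions of the subquotient orders\<close>

abbreviation proper :: "('l::bounded_lattice, 's) language \<Rightarrow> 's set" where
  "proper L \<equiv> {s \<in> order_syms L. bot_rel L s \<noteq> top_rel L s}"

section \<open>Ranking of the symbols\<close>

lemma exists_ranking:
  fixes h :: "'s \<Rightarrow> 'l::{finite, order}"
  assumes "finite S"
  shows "\<exists>\<iota>::'s \<Rightarrow> nat. inj_on \<iota> S \<and> (\<forall>s\<in>S. \<forall>t\<in>S. h s < h t \<longrightarrow> \<iota> t < \<iota> s)"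
proof -
  obtain j :: "'s \<Rightarrow> nat" and n where j: "j ` S = {i. i < n}" "inj_on j S"
    using finite_imp_inj_to_nat_seg[OF assms] by blast
  have jn: "j s < n" if "s \<in> S" for s using j(1) that by blast
  \<comment> \<open>Fewer elements lie strictly above a larger \<open>h s\<close>, so
    \<open>c\<close> reverses the order. As \<open>j s < n\<close>, the number
    \<open>c s * n + j s\<close> compares first by \<open>c\<close>, and \<open>j\<close> breaks
    ties.\<close>
  define c where "c s = card {l. h s < l}" for s
  have c: "c t < c s" if "h s < h t" for s t
    unfolding c_def using that by (intro psubset_card_mono) (auto intro: less_trans)
  have "inj_on (\<lambda>s. c s * n + j s) S"
  proof (rule inj_onI)
    fix s t assume st: "s \<in> S" "t \<in> S" "c s * n + j s = c t * n + j t"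
    then have "j s = j t" using jn by (metis mod_less mod_mult_self3)
    then show "s = t" using st j(2) by (simp add: inj_on_eq_iff)
  qed
  moreover have "c t * n + j t < c s * n + j s" if "s \<in> S" "t \<in> S" "h s < h t" for s t
  proof -
    have "c t * n + j t < Suc (c t) * n" using jn[OF that(2)] by simp
    also have "\<dots> \<le> c s * n" using c[OF that(3)] by (intro mult_right_mono) auto
    finally show ?thesis by simp
  qed
  ultimately show ?thesis by (intro exI[of _ "\<lambda>s. c s * n + j s"]) blast
qed

text \<open>The ranking lists coarser bottom relations first. It selects the symbol that compares
  two points in \<open>ext_less\<close>, and it keeps the labels of different symbols in separate
  blocks in \<open>prec\<close>.\<close>

locale ranked_language =
  fixes L :: "('l::{finite, distrib_lattice, bounded_lattice}, 's) language" and \<iota> :: "'s \<Rightarrow> nat"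
  assumes well_equipped: "well_equipped L"
    and inj: "inj_on \<iota> (proper L)"
    and antitone: "\<lbrakk>s \<in> proper L; t \<in> proper L; bot_rel L s < bot_rel L t\<rbrakk> \<Longrightarrow> \<iota> t < \<iota> s"
begin

abbreviation S where "S \<equiv> proper L"

text \<open>\<open>ext_less M s\<close> extends the order \<open>s\<close> to a linear order of all
  \<open>bot_rel L s\<close>-classes, in which the \<open>top_rel L s\<close>-classes are convex: points in
  different \<open>top_rel L s\<close>-classes are compared by the first symbol above
  \<open>top_rel L s\<close> that separates them. It is quantifier-free definable, so embeddings
  preserve it.\<close>

definition keys :: "'s \<Rightarrow> 's set" where
  "keys s = insert s {t \<in> S. top_rel L s \<le> bot_rel L t}"

definition ext_less :: "('a, ('l, 's) symbol) struct \<Rightarrow> 's \<Rightarrow> 'a \<Rightarrow> 'a \<Rightarrow> bool" where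
  "ext_less M s x y \<longleftrightarrow> (\<exists>t\<in>keys s. (x, y) \<in> interp M (Ord t) \<and>
     (\<forall>u\<in>keys s. \<iota> u < \<iota> t \<longrightarrow> sim M (bot_rel L u) x y))"

text \<open>Over a member of the lift, two pairs with symbols in \<open>S\<close> are incomparable
  exactly when they have the same symbol \<open>s\<close> and points in one
  \<open>bot_rel L s\<close>-class. A single label set therefore serves all coordinates.\<close>

fun prec :: "('a, ('l, 's) symbol) struct \<Rightarrow> 's \<times> 'a \<Rightarrow> 's \<times> 'a \<Rightarrow> bool" where
  "prec M (s, x) (t, y) \<longleftrightarrow> \<iota> s < \<iota> t \<or> s = t \<and> ext_less M s x y"

lemma language: "is_language L"
  using well_equipped by (simp add: well_equipped_def)

lemma finite_S: "finite S"
  using language by (simp add: is_language_def)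

lemma bot_less_top: "s \<in> S \<Longrightarrow> bot_rel L s < top_rel L s"
  using language by (auto simp: is_language_def)

lemma meet_irreducible_iff: "meet_irreducible m \<longleftrightarrow> (\<exists>s\<in>S. bot_rel L s = m)"
  using well_equipped unfolding well_equipped_def by fastforce

text \<open>Every meet-irreducible is the bottom relation of some symbol in \<open>S\<close>, so
  these elements suffice to test inequalities.\<close>

lemma le_iff: "l \<le> F \<longleftrightarrow> (\<forall>t\<in>S. F \<le> bot_rel L t \<longrightarrow> l \<le> bot_rel L t)"
  unfolding le_iff_meet_irreducibles[of l F] meet_irreducible_iff by blast

lemma keys_subset: "s \<in> S \<Longrightarrow> keys s \<subseteq> S"
  by (auto simp: keys_def)

lemma bot_le_keys: "\<lbrakk>s \<in> S; t \<in> keys s\<rbrakk> \<Longrightarrow> bot_rel L s \<le> bot_rel L t"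
  using bot_less_top[of s] by (auto simp: keys_def)

lemma embedding_sim:
  assumes "embedding f M N" "x \<in> univ M" "y \<in> univ M"
  shows "sim N F (f x) (f y) \<longleftrightarrow> sim M F x y"
  using assms unfolding embedding_def sim_def by blast

lemma embedding_ext_less:
  assumes "embedding f M N" "x \<in> univ M" "y \<in> univ M"
  shows "ext_less N s (f x) (f y) \<longleftrightarrow> ext_less M s x y"
  using assms unfolding ext_less_def by (simp add: embedding_sim) (simp add: embedding_def)

text \<open>Embeddings preserve and reflect \<open>prec\<close>, so a labelling of \<open>N\<close>
  pulls back to every \<open>M\<close> embedded in it.\<close>

lemma embedding_represents:
  assumes f: "embedding f M N" and \<phi>: "represents (S \<times> univ N) (prec N) \<phi>"
  shows "represents (S \<times> univ M) (prec M) (\<lambda>(s, x). \<phi> (s, f x))"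
proof -
  have "f x \<in> univ N" if "x \<in> univ M" for x
    using f that unfolding embedding_def by blast
  then show ?thesis
    using \<phi> embedding_ext_less[OF f] unfolding represents_def by auto
qed

section \<open>Similarity relations and orders in one member of the lift\<close>

context
  fixes M :: "('a, ('l, 's) symbol) struct"
  assumes M: "M \<in> lift L"
begin

lemma lift_dist:
  obtains d where "ultrametric (univ M) d"
    "\<And>l x y. (x, y) \<in> interp M (Dist l) \<longleftrightarrow> x \<in> univ M \<and> y \<in> univ M \<and> d x y = l"
    "\<And>F x y. sim M F x y \<longleftrightarrow> x \<in> univ M \<and> y \<in> univ M \<and> d x y \<le> F"
    "\<And>s x y. \<lbrakk>s \<in> order_syms L; x \<in> univ M; y \<in> univ M\<rbrakk> \<Longrightarrow>
        ((x, y) \<in> interp M (Ord s) \<longrightarrow> \<not> d x y \<le> bot_rel L s) \<and>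
          (d x y \<le> top_rel L s \<longleftrightarrow> d x y \<le> bot_rel L s \<or>
            (x, y) \<in> interp M (Ord s) \<or> (y, x) \<in> interp M (Ord s))"
proof -
  obtain d where d: "ultrametric (univ M) d"
    and dist: "\<And>l. interp M (Dist l) = {(x, y) \<in> univ M \<times> univ M. d x y = l}"
    and ord: "\<And>s x y. s \<in> order_syms L \<Longrightarrow> x \<in> univ M \<Longrightarrow> y \<in> univ M \<Longrightarrow>
        ((x, y) \<in> interp M (Ord s) \<longrightarrow> \<not> d x y \<le> bot_rel L s) \<and>
          (d x y \<le> top_rel L s \<longleftrightarrow> d x y \<le> bot_rel L s \<or>
            (x, y) \<in> interp M (Ord s) \<or> (y, x) \<in> interp M (Ord s))"
    using M unfolding lift_iff[OF language] by blast
  show ?thesis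
    by (rule that[OF d _ _ ord]) (auto simp: dist sim_def)
qed

lemma finite_univ: "finite (univ M)"
  using M by (simp add: lift_def)

lemma sim_in: "sim M F x y \<Longrightarrow> x \<in> univ M \<and> y \<in> univ M"
  by (rule lift_dist) blast

lemma sim_refl: "x \<in> univ M \<Longrightarrow> sim M F x x"
proof (rule lift_dist)
  fix d assume "x \<in> univ M" and d: "ultrametric (univ M) d"
    and sim: "\<And>F x y. sim M F x y \<longleftrightarrow> x \<in> univ M \<and> y \<in> univ M \<and> d x y \<le> F"
  then have "d x x = bot" by (simp add: ultrametric_def)
  then show ?thesis using sim \<open>x \<in> univ M\<close> by simp
qed

lemma sim_sym: "sim M F x y \<Longrightarrow> sim M F y x"
proof (rule lift_dist)
  fix d assume xy: "sim M F x y" and d: "ultrametric (univ M) d"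
    and sim: "\<And>F x y. sim M F x y \<longleftrightarrow> x \<in> univ M \<and> y \<in> univ M \<and> d x y \<le> F"
  have "x \<in> univ M" "y \<in> univ M" "d x y \<le> F" using xy sim by auto
  moreover from this have "d y x = d x y" using d unfolding ultrametric_def by blast
  ultimately show ?thesis using sim by simp
qed

lemma sim_trans: "\<lbrakk>sim M F x y; sim M F y z\<rbrakk> \<Longrightarrow> sim M F x z"
proof (rule lift_dist)
  fix d assume xy: "sim M F x y" "sim M F y z" and d: "ultrametric (univ M) d"
    and sim: "\<And>F x y. sim M F x y \<longleftrightarrow> x \<in> univ M \<and> y \<in> univ M \<and> d x y \<le> F"
  have "x \<in> univ M" "y \<in> univ M" "z \<in> univ M" "d x y \<le> F" "d y z \<le> F" using xy sim by auto
  moreover from this have "d x z \<le> F"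
    using d unfolding ultrametric_def by (meson le_supI order_trans)
  ultimately show ?thesis using sim by simp
qed

lemma sim_bot: "\<lbrakk>x \<in> univ M; y \<in> univ M\<rbrakk> \<Longrightarrow> sim M bot x y \<longleftrightarrow> x = y"
proof (rule lift_dist)
  fix d assume "x \<in> univ M" "y \<in> univ M" and d: "ultrametric (univ M) d"
    and sim: "\<And>F x y. sim M F x y \<longleftrightarrow> x \<in> univ M \<and> y \<in> univ M \<and> d x y \<le> F"
  then show ?thesis by (simp add: ultrametric_def bot_unique)
qed

lemma sim_mono: "\<lbrakk>sim M F x y; F \<le> G\<rbrakk> \<Longrightarrow> sim M G x y"
  unfolding sim_def by (meson order_trans)

text \<open>This is \<open>le_iff\<close> for the distance of \<open>x\<close> and \<open>y\<close>.
  Labels thus only have to control the relations \<open>bot_rel L t\<close>.\<close>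

lemma sim_iff:
  assumes "x \<in> univ M" "y \<in> univ M"
  shows "sim M F x y \<longleftrightarrow> (\<forall>t\<in>S. F \<le> bot_rel L t \<longrightarrow> sim M (bot_rel L t) x y)"
proof (rule lift_dist)
  fix d assume "\<And>F x y. sim M F x y \<longleftrightarrow> x \<in> univ M \<and> y \<in> univ M \<and> d x y \<le> F"
  then show ?thesis using assms le_iff[of "d x y" F] by simp
qed

text \<open>The distance is the least \<open>F\<close> that relates the points, so maps preserving
  and reflecting every \<open>sim\<close> preserve distances.\<close>

lemma dist_iff_sim:
  "(x, y) \<in> interp M (Dist l) \<longleftrightarrow>
    x \<in> univ M \<and> y \<in> univ M \<and> (\<forall>F. sim M F x y \<longleftrightarrow> l \<le> F)"
proof (rule lift_dist)
  fix d assume "\<And>F x y. sim M F x y \<longleftrightarrow> x \<in> univ M \<and> y \<in> univ M \<and> d x y \<le> F"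
    and "\<And>l x y. (x, y) \<in> interp M (Dist l) \<longleftrightarrow> x \<in> univ M \<and> y \<in> univ M \<and> d x y = l"
  then show ?thesis by (auto intro: antisym)
qed

lemma ord_in: "(x, y) \<in> interp M (Ord s) \<Longrightarrow> x \<in> univ M \<and> y \<in> univ M"
  using M unfolding lift_def is_struct_def by blast

lemma ord_sym: "(x, y) \<in> interp M (Ord s) \<Longrightarrow> s \<in> order_syms L"
  using M unfolding lift_def by blast

lemma ord_not_sim: "(x, y) \<in> interp M (Ord s) \<Longrightarrow> \<not> sim M (bot_rel L s) x y"
  by (rule lift_dist) (use ord_in ord_sym in blast)

lemma ord_iff:
  assumes "s \<in> order_syms L" "x \<in> univ M" "y \<in> univ M"
  shows "sim M (top_rel L s) x y \<longleftrightarrow> sim M (bot_rel L s) x y \<or>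
    (x, y) \<in> interp M (Ord s) \<or> (y, x) \<in> interp M (Ord s)"
proof (rule lift_dist)
  fix d assume "\<And>F x y. sim M F x y \<longleftrightarrow> x \<in> univ M \<and> y \<in> univ M \<and> d x y \<le> F"
    and "\<And>s x y. \<lbrakk>s \<in> order_syms L; x \<in> univ M; y \<in> univ M\<rbrakk> \<Longrightarrow>
        ((x, y) \<in> interp M (Ord s) \<longrightarrow> \<not> d x y \<le> bot_rel L s) \<and>
          (d x y \<le> top_rel L s \<longleftrightarrow> d x y \<le> bot_rel L s \<or>
            (x, y) \<in> interp M (Ord s) \<or> (y, x) \<in> interp M (Ord s))"
  then show ?thesis using assms by simp
qed

lemma ord_sim_top: "(x, y) \<in> interp M (Ord s) \<Longrightarrow> sim M (top_rel L s) x y"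
  using ord_iff ord_in ord_sym by blast

lemma ord_proper: "(x, y) \<in> interp M (Ord s) \<Longrightarrow> s \<in> S"
  using ord_sym ord_not_sim ord_sim_top by fastforce

lemma ord_trans:
  "\<lbrakk>(x, y) \<in> interp M (Ord s); (y, z) \<in> interp M (Ord s)\<rbrakk> \<Longrightarrow> (x, z) \<in> interp M (Ord s)"
proof -
  assume xy: "(x, y) \<in> interp M (Ord s)" and yz: "(y, z) \<in> interp M (Ord s)"
  have "trans (interp M (Ord s))"
    using M ord_sym[OF xy] unfolding lift_iff[OF language] by blast
  then show ?thesis using xy yz by (rule transD)
qed

lemma ord_asym: "(x, y) \<in> interp M (Ord s) \<Longrightarrow> (y, x) \<notin> interp M (Ord s)"
  using ord_trans ord_not_sim sim_refl ord_in by blast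

text \<open>Trichotomy applies to \<open>x'\<close> and \<open>y\<close> inside their top class;
  each alternative would, by transitivity, relate two \<open>bot_rel L s\<close>-similar points by
  the order.\<close>

lemma ord_sim_left:
  assumes "sim M (bot_rel L s) x' x" "(x, y) \<in> interp M (Ord s)"
  shows "(x', y) \<in> interp M (Ord s)"
proof -
  have s: "s \<in> order_syms L" using ord_sym assms(2) .
  then have "bot_rel L s \<le> top_rel L s" using language by (simp add: is_language_def)
  then have "sim M (top_rel L s) x' y"
    using assms sim_mono ord_sim_top sim_trans by blast
  then have "sim M (bot_rel L s) x' y \<or> (x', y) \<in> interp M (Ord s) \<or> (y, x') \<in> interp M (Ord s)"
    using ord_iff[OF s] sim_in by blast
  then show ?thesis
    using assms ord_not_sim ord_trans sim_sym sim_trans by meson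
qed

lemma ord_sim_right:
  assumes "(x, y) \<in> interp M (Ord s)" "sim M (bot_rel L s) y y'"
  shows "(x, y') \<in> interp M (Ord s)"
proof -
  have s: "s \<in> order_syms L" using ord_sym assms(1) .
  then have "bot_rel L s \<le> top_rel L s" using language by (simp add: is_language_def)
  then have "sim M (top_rel L s) x y'"
    using assms sim_mono ord_sim_top sim_trans by blast
  then have "sim M (bot_rel L s) x y' \<or> (x, y') \<in> interp M (Ord s) \<or> (y', x) \<in> interp M (Ord s)"
    using ord_iff[OF s] sim_in by blast
  then show ?thesis
    using assms ord_not_sim ord_trans sim_sym sim_trans by meson
qed

section \<open>The extended orders are strict weak orders\<close>

lemma ext_less_in: "ext_less M s x y \<Longrightarrow> x \<in> univ M \<and> y \<in> univ M"
  unfolding ext_less_def using ord_in by blast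

text \<open>The symbol \<open>s\<close> itself is the witness: every other key has a bottom relation
  containing \<open>top_rel L s\<close>, so it does not separate \<open>x\<close> and
  \<open>y\<close>.\<close>

lemma ord_imp_ext_less:
  assumes s: "s \<in> S" and xy: "(x, y) \<in> interp M (Ord s)"
  shows "ext_less M s x y"
  unfolding ext_less_def
proof (intro bexI conjI ballI impI)
  show "s \<in> keys s" by (simp add: keys_def)
  fix u assume "u \<in> keys s" "\<iota> u < \<iota> s"
  then have "top_rel L s \<le> bot_rel L u" by (auto simp: keys_def)
  then show "sim M (bot_rel L u) x y" using ord_sim_top[OF xy] sim_mono by blast
qed (rule xy)

lemma ext_less_not_sim:
  assumes s: "s \<in> S" and xy: "ext_less M s x y"
  shows "\<not> sim M (bot_rel L s) x y"
  using xy bot_le_keys[OF s] ord_not_sim sim_mono unfolding ext_less_def by blast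

lemma ext_less_total:
  assumes s: "s \<in> S" and xy: "x \<in> univ M" "y \<in> univ M" "\<not> sim M (bot_rel L s) x y"
  shows "ext_less M s x y \<or> ext_less M s y x"
proof -
  \<comment> \<open>The comparing symbol is the key of least rank that separates \<open>x\<close>
    and \<open>y\<close>.\<close>
  define T where "T = {t \<in> keys s. \<not> sim M (bot_rel L t) x y}"
  have "s \<in> T" using xy by (simp add: T_def keys_def)
  then obtain t where t: "t \<in> T" and min: "\<And>u. u \<in> T \<Longrightarrow> \<iota> t \<le> \<iota> u"
    using ex_has_least_nat[of "\<lambda>t. t \<in> T" s \<iota>] by blast
  have tS: "t \<in> S" using t keys_subset[OF s] by (auto simp: T_def)
  have before: "sim M (bot_rel L u) x y" if "u \<in> keys s" "\<iota> u < \<iota> t" for u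
    using min[of u] that by (auto simp: T_def)
  \<comment> \<open>It suffices to test the bottom relations above \<open>top_rel L t\<close>. Each
    strictly contains \<open>bot_rel L t\<close>, so its symbol is ranked earlier; it is also a key,
    and minimality of \<open>t\<close> applies.\<close>
  have "sim M (top_rel L t) x y"
  proof (rule sim_iff[OF xy(1,2), THEN iffD2], intro ballI impI)
    fix u assume u: "u \<in> S" "top_rel L t \<le> bot_rel L u"
    have less: "bot_rel L t < bot_rel L u"
      using bot_less_top[OF tS] u(2) by (rule less_le_trans)
    have "top_rel L s \<le> bot_rel L u"
    proof (cases "t = s")
      case False
      then have "top_rel L s \<le> bot_rel L t" using t by (auto simp: T_def keys_def)
      then show ?thesis using less by (meson less_imp_le order_trans)
    qed (use u in simp)
    then have "u \<in> keys s" using u by (simp add: keys_def)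
    then show "sim M (bot_rel L u) x y" using before antitone[OF tS u(1) less] by blast
  qed
  then have "(x, y) \<in> interp M (Ord t) \<or> (y, x) \<in> interp M (Ord t)"
    using ord_iff[of t] tS t xy by (auto simp: T_def)
  then show ?thesis
    unfolding ext_less_def using t before sim_sym by (auto simp: T_def)
qed

text \<open>As for lexicographic orders: if the two comparing symbols differ, the other pair is
  similar at the earlier one, whose order is invariant under its bottom relation; if they coincide,
  that order is transitive.\<close>

lemma ext_less_trans:
  assumes s: "s \<in> S" and xy: "ext_less M s x y" and yz: "ext_less M s y z"
  shows "ext_less M s x z"
proof -
  obtain t where t: "t \<in> keys s" "(x, y) \<in> interp M (Ord t)"
    and tb: "\<And>u. u \<in> keys s \<Longrightarrow> \<iota> u < \<iota> t \<Longrightarrow> sim M (bot_rel L u) x y"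
    using xy unfolding ext_less_def by blast
  obtain v where v: "v \<in> keys s" "(y, z) \<in> interp M (Ord v)"
    and vb: "\<And>u. u \<in> keys s \<Longrightarrow> \<iota> u < \<iota> v \<Longrightarrow> sim M (bot_rel L u) y z"
    using yz unfolding ext_less_def by blast
  have both: "sim M (bot_rel L u) x z" if "u \<in> keys s" "\<iota> u < \<iota> t" "\<iota> u < \<iota> v" for u
    using tb[of u] vb[of u] that sim_trans by blast
  consider "\<iota> t < \<iota> v" | "\<iota> v < \<iota> t" | "t = v"
    using inj_onD[OF inj, of t v] keys_subset[OF s] t(1) v(1) by (meson linorder_less_linear subsetD)
  then show ?thesis
  proof cases
    case 1
    then have "(x, z) \<in> interp M (Ord t)" using ord_sim_right t vb by blast
    then show ?thesis unfolding ext_less_def using t(1) 1 both by (meson less_trans)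
  next
    case 2
    then have "(x, z) \<in> interp M (Ord v)" using ord_sim_left v tb by blast
    then show ?thesis unfolding ext_less_def using v(1) 2 both by (meson less_trans)
  next
    case 3
    then have "(x, z) \<in> interp M (Ord t)" using ord_trans t v by blast
    then show ?thesis unfolding ext_less_def using t(1) 3 both by blast
  qed
qed

lemma ext_less_irrefl: "s \<in> S \<Longrightarrow> \<not> ext_less M s x x"
  using ext_less_not_sim sim_refl ext_less_in by blast

text \<open>The point \<open>y\<close> is separated from \<open>x\<close> or from \<open>z\<close>;
  totality compares that pair, and transitivity settles the wrong direction.\<close>

lemma ext_less_negtrans:
  assumes s: "s \<in> S" and xz: "ext_less M s x z" and y: "y \<in> univ M"
  shows "ext_less M s x y \<or> ext_less M s y z"
proof -
  have "x \<in> univ M" "z \<in> univ M" using xz ext_less_in by auto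
  have "\<not> sim M (bot_rel L s) x z" using s xz by (rule ext_less_not_sim)
  then have "\<not> sim M (bot_rel L s) x y \<or> \<not> sim M (bot_rel L s) y z"
    using sim_trans by blast
  then show ?thesis
  proof
    assume "\<not> sim M (bot_rel L s) x y"
    then have "ext_less M s x y \<or> ext_less M s y x"
      using ext_less_total[OF s \<open>x \<in> univ M\<close> y] by blast
    then show ?thesis using ext_less_trans[OF s] xz by blast
  next
    assume "\<not> sim M (bot_rel L s) y z"
    then have "ext_less M s y z \<or> ext_less M s z y"
      using ext_less_total[OF s y \<open>z \<in> univ M\<close>] by blast
    then show ?thesis using ext_less_trans[OF s] xz by blast
  qed
qed

lemma prec_represented: "\<exists>\<phi>. represents (S \<times> univ M) (prec M) \<phi>"
proof (rule represents_exists)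
  show "finite (S \<times> univ M)" using finite_S finite_univ by (rule finite_cartesian_product)
  show "\<not> prec M v v" if "v \<in> S \<times> univ M" for v
    using that ext_less_irrefl by (cases v) auto
  show "prec M u w" if "u \<in> S \<times> univ M" "v \<in> S \<times> univ M" "w \<in> S \<times> univ M" "prec M u v" "prec M v w" for u v w
    using that by (cases u; cases v; cases w) (auto intro: ext_less_trans)
  show "prec M u v \<or> prec M v w"
    if uvw: "u \<in> S \<times> univ M" "v \<in> S \<times> univ M" "w \<in> S \<times> univ M" and uw: "prec M u w" for u v w
  proof -
    obtain r x s y t z where eq: "u = (r, x)" "v = (s, y)" "w = (t, z)"
      by (metis surj_pair)
    have rst: "r \<in> S" "s \<in> S" "t \<in> S" "y \<in> univ M" using uvw eq by auto
    show ?thesis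
    proof (cases "\<iota> r < \<iota> s \<or> \<iota> s < \<iota> t")
      case False
      \<comment> \<open>From \<open>prec M u w\<close> one has
        \<open>\<iota> r \<le> \<iota> t\<close>, and the failed inequalities give
        \<open>\<iota> t \<le> \<iota> s \<le> \<iota> r\<close>.\<close>
      then have "r = t" "\<iota> s = \<iota> r" "ext_less M r x z" using uw eq by auto
      then have "s = r" using inj rst by (simp add: inj_on_eq_iff)
      then show ?thesis
        using ext_less_negtrans[OF rst(1) \<open>ext_less M r x z\<close> rst(4)] eq \<open>r = t\<close> by auto
    qed (use eq in auto)
  qed
qed

end

section \<open>The ambient structure\<close>

definition agree :: "'l \<Rightarrow> ('s \<Rightarrow> nat) \<Rightarrow> ('s \<Rightarrow> nat) \<Rightarrow> bool" where
  "agree F x y \<longleftrightarrow> (\<forall>t\<in>S. F \<le> bot_rel L t \<longrightarrow> x t = y t)"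

text \<open>Distributivity enters here: it provides a distance inducing the relations \<open>agree F\<close>.\<close>

lemma agree_dist: "\<exists>l. \<forall>F. l \<le> F \<longleftrightarrow> agree F x y"
proof -
  \<comment> \<open>The distance is the meet of those \<open>bot_rel L t\<close> at which
    \<open>x\<close> and \<open>y\<close> agree.\<close>
  obtain l where l: "\<And>m. meet_irreducible m \<Longrightarrow>
      l \<le> m \<longleftrightarrow> (\<exists>a\<in>{bot_rel L t |t. t \<in> S \<and> agree (bot_rel L t) x y}. a \<le> m)"
    using meet_of_finite_set[of "{bot_rel L t |t. t \<in> S \<and> agree (bot_rel L t) x y}"] by auto
  have mono: "agree F x y \<Longrightarrow> F \<le> G \<Longrightarrow> agree G x y" for F G
    unfolding agree_def by (meson order_trans)
  \<comment> \<open>No further meet-irreducible gets above \<open>l\<close>, since agreement passes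
    to coarser relations.\<close>
  have bot: "l \<le> bot_rel L t \<longleftrightarrow> agree (bot_rel L t) x y" if "t \<in> S" for t
    using l[of "bot_rel L t"] that mono unfolding meet_irreducible_iff by blast
  have "l \<le> F \<longleftrightarrow> agree F x y" for F
  proof -
    have "l \<le> F \<longleftrightarrow> (\<forall>t\<in>S. F \<le> bot_rel L t \<longrightarrow> agree (bot_rel L t) x y)"
      using le_iff[of l F] bot by blast
    also have "\<dots> \<longleftrightarrow> agree F x y"
      unfolding agree_def by (meson order_refl order_trans)
    finally show ?thesis .
  qed
  then show ?thesis by blast
qed

text \<open>Points of one \<open>top_rel L s\<close>-class with equal \<open>s\<close>-th coordinate
  may still lie in different \<open>bot_rel L s\<close>-classes, so trichotomy requires a tie-break.
  The last clause records only comparisons by the coordinate itself.\<close>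

lemma ambient_exists:
  "\<exists>C \<in> lift L. univ C = S \<rightarrow>\<^sub>E {..<N} \<and>
    (\<forall>F. \<forall>x\<in>univ C. \<forall>y\<in>univ C. sim C F x y \<longleftrightarrow> agree F x y) \<and>
    (\<forall>s\<in>S. \<forall>x\<in>univ C. \<forall>y\<in>univ C. agree (top_rel L s) x y \<longrightarrow> x s < y s \<longrightarrow> (x, y) \<in> interp C (Ord s))"
proof -
  define Y :: "('s \<Rightarrow> nat) set" where "Y = S \<rightarrow>\<^sub>E {..<N}"
  have finY: "finite Y" unfolding Y_def using finite_S by (simp add: finite_PiE)
  obtain d where d: "\<And>x y F. d x y \<le> F \<longleftrightarrow> agree F x y"
    using agree_dist by metis
  \<comment> \<open>The restriction \<open>res s x\<close> names the
    \<open>bot_rel L s\<close>-class of \<open>x\<close>; \<open>code\<close> turns it into a number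
    used to break ties.\<close>
  define res where "res s x = restrict x {t \<in> S. bot_rel L s \<le> bot_rel L t}" for s and x :: "'s \<Rightarrow> nat"
  have res: "res s x = res s y \<longleftrightarrow> agree (bot_rel L s) x y" for s x y
    unfolding res_def agree_def by (auto simp: restrict_def fun_eq_iff)
  have "finite (\<Union>s\<in>S. res s ` Y)" using finY finite_S by simp
  then obtain \<kappa> :: "('s \<Rightarrow> nat) \<Rightarrow> nat" where \<kappa>: "inj_on \<kappa> (\<Union>s\<in>S. res s ` Y)"
    using finite_imp_inj_to_nat_seg[of "\<Union>s\<in>S. res s ` Y"] by blast
  define code where "code s x = \<kappa> (res s x)" for s x
  have code: "code s x = code s y \<longleftrightarrow> agree (bot_rel L s) x y" if "s \<in> S" "x \<in> Y" "y \<in> Y" for s x y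
    using \<kappa> that unfolding code_def res[symmetric] by (auto simp: inj_on_def)
  define lt where "lt s x y \<longleftrightarrow> s \<in> S \<and> x \<in> Y \<and> y \<in> Y \<and> agree (top_rel L s) x y \<and>
      (x s < y s \<or> x s = y s \<and> code s x < code s y)" for s x y
  define C where "C = \<lparr>univ = Y, interp = \<lambda>r. case r of
      Dist l \<Rightarrow> {(x, y) \<in> Y \<times> Y. d x y = l} | Ord s \<Rightarrow> {(x, y). lt s x y}\<rparr>"
  have agree_refl: "agree F x x" and agree_sym: "agree F x y \<Longrightarrow> agree F y x"
    and agree_trans: "agree F x y \<Longrightarrow> agree F y z \<Longrightarrow> agree F x z"
    and agree_mono: "agree F x y \<Longrightarrow> F \<le> G \<Longrightarrow> agree G x y" for F G x y z
    unfolding agree_def by (auto intro: order_trans)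
  have lt_trans: "lt s x z" if "lt s x y" "lt s y z" for s x y z
    using that agree_trans[of "top_rel L s" x y z] unfolding lt_def by auto
  have lt_agree: "\<not> agree (bot_rel L s) x y" if "lt s x y" for s x y
  proof
    assume a: "agree (bot_rel L s) x y"
    have "s \<in> S" "x \<in> Y" "y \<in> Y" using that by (auto simp: lt_def)
    then have "x s = y s" "code s x = code s y" using a code by (auto simp: agree_def)
    then show False using that by (simp add: lt_def)
  qed
  have lt_total: "agree (top_rel L s) x y \<longleftrightarrow> agree (bot_rel L s) x y \<or> lt s x y \<or> lt s y x"
    if s: "s \<in> order_syms L" and xy: "x \<in> Y" "y \<in> Y" for s x y
  proof (cases "s \<in> S")
    case True
    show ?thesis
    proof
      assume t: "agree (top_rel L s) x y"
      show "agree (bot_rel L s) x y \<or> lt s x y \<or> lt s y x"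
        using t agree_sym[OF t] code[OF True xy] True xy unfolding lt_def by (auto simp: not_less_iff_gr_or_eq)
    next
      assume "agree (bot_rel L s) x y \<or> lt s x y \<or> lt s y x"
      then show "agree (top_rel L s) x y"
        using agree_mono bot_less_top[OF True] agree_sym unfolding lt_def by (meson less_imp_le)
    qed
  next
    case False
    then show ?thesis using s by (auto simp: lt_def)
  qed
  have d_eq: "d x y = d y x" for x y
    using d agree_sym by (meson antisym order_refl)
  have d_tri: "d x z \<le> sup (d x y) (d y z)" for x y z
  \<comment> \<open>Both distances lie below their join, so the claim is transitivity of
    \<open>agree\<close> at the join.\<close>
  proof -
    have "d x y \<le> sup (d x y) (d y z)" "d y z \<le> sup (d x y) (d y z)" by simp_all
    then show ?thesis unfolding d by (rule agree_trans)
  qed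
  have d_bot: "d x y = bot \<longleftrightarrow> x = y" if "x \<in> Y" "y \<in> Y" for x y
  proof -
    have "d x y = bot \<longleftrightarrow> agree bot x y" by (simp add: d[symmetric] bot_unique)
    \<comment> \<open>At \<open>bot\<close> all coordinates in \<open>S\<close> are compared, and
      these determine an extensional function.\<close>
    also have "\<dots> \<longleftrightarrow> x = y"
      using that unfolding Y_def agree_def by (auto intro: PiE_ext)
    finally show ?thesis .
  qed
  have univ_C: "univ C = Y" and dist_C: "interp C (Dist l) = {(x, y) \<in> Y \<times> Y. d x y = l}"
    and ord_C: "interp C (Ord s) = {(x, y). lt s x y}" for l s
    by (simp_all add: C_def)
  have "C \<in> lift L"
    unfolding lift_iff[OF language] univ_C dist_C ord_C
  proof (intro conjI exI[of _ d] allI ballI impI)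
    have "interp C r \<subseteq> Y \<times> Y" for r
      by (cases r) (auto simp: dist_C ord_C lt_def)
    then show "is_struct C" by (simp add: is_struct_def univ_C)
    show "finite Y" by (rule finY)
    show "ultrametric Y d"
      unfolding ultrametric_def using d_eq d_tri d_bot by blast
    show "trans {(x, y). lt s x y}" for s
      using lt_trans unfolding trans_def by blast
    show "\<not> d x y \<le> bot_rel L s" if "(x, y) \<in> {(x, y). lt s x y}" for s x y
      using lt_agree that by (simp add: d)
    show "d x y \<le> top_rel L s \<longleftrightarrow> d x y \<le> bot_rel L s \<or>
        (x, y) \<in> {(x, y). lt s x y} \<or> (y, x) \<in> {(x, y). lt s x y}"
      if "s \<in> order_syms L" "x \<in> Y" "y \<in> Y" for s x y
      using lt_total[OF that] by (simp add: d)
    show "{(x, y). lt s x y} = {}" if "s \<notin> order_syms L" for s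
      using that by (simp add: lt_def)
  qed simp
  moreover have "sim C F x y \<longleftrightarrow> agree F x y" if "x \<in> Y" "y \<in> Y" for F x y
    using that by (auto simp: sim_def dist_C d[symmetric])
  moreover have "(x, y) \<in> interp C (Ord s)"
    if "s \<in> S" "x \<in> Y" "y \<in> Y" "agree (top_rel L s) x y" "x s < y s" for s x y
    using that by (simp add: ord_C lt_def)
  ultimately show ?thesis
    unfolding Y_def[symmetric] by (intro bexI[of _ C]) (simp_all add: univ_C)
qed

section \<open>Labellings as embeddings into the ambient structure\<close>

lemma labelling_embedding:
  assumes M: "M \<in> lift L" and C: "C \<in> lift L"
    and univ_C: "univ C = S \<rightarrow>\<^sub>E {..<N}"
    and sim_C: "\<And>F x y. \<lbrakk>x \<in> univ C; y \<in> univ C\<rbrakk> \<Longrightarrow> sim C F x y \<longleftrightarrow> agree F x y"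
    and ord_C: "\<And>s x y. \<lbrakk>s \<in> S; x \<in> univ C; y \<in> univ C; agree (top_rel L s) x y; x s < y s\<rbrakk>
      \<Longrightarrow> (x, y) \<in> interp C (Ord s)"
    and \<phi>: "represents (S \<times> univ M) (prec M) \<phi>" and range: "\<phi> ` (S \<times> univ M) \<subseteq> {..<N}"
  shows "embedding (\<lambda>x. \<lambda>s\<in>S. \<phi> (s, x)) M C"
proof -
  define p where "p x = (\<lambda>s\<in>S. \<phi> (s, x))" for x
  have pC: "p x \<in> univ C" if "x \<in> univ M" for x
    using range that unfolding p_def univ_C by (intro restrict_PiE_iff[THEN iffD2]) blast
  have \<phi>_less: "\<phi> (s, x) < \<phi> (s, y) \<longleftrightarrow> ext_less M s x y"
    if "s \<in> S" "x \<in> univ M" "y \<in> univ M" for s x y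
    using \<phi> that unfolding represents_def by simp
  \<comment> \<open>Equal labels mean that \<open>ext_less\<close> compares the points in neither
    direction, which by totality is similarity.\<close>
  have \<phi>_eq: "\<phi> (s, x) = \<phi> (s, y) \<longleftrightarrow> sim M (bot_rel L s) x y"
    if sxy: "s \<in> S" "x \<in> univ M" "y \<in> univ M" for s x y
  proof
    assume "\<phi> (s, x) = \<phi> (s, y)"
    then have "\<not> ext_less M s x y" "\<not> ext_less M s y x"
      using \<phi>_less[OF sxy] \<phi>_less[OF sxy(1,3,2)] by auto
    then show "sim M (bot_rel L s) x y" using ext_less_total[OF M sxy] by blast
  next
    assume "sim M (bot_rel L s) x y"
    then have "\<not> ext_less M s x y" "\<not> ext_less M s y x"
      using ext_less_not_sim[OF M sxy(1)] sim_sym[OF M] by blast+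
    then show "\<phi> (s, x) = \<phi> (s, y)"
      using \<phi>_less[OF sxy] \<phi>_less[OF sxy(1,3,2)] by auto
  qed
  have agree_p: "agree F (p x) (p y) \<longleftrightarrow> sim M F x y" if "x \<in> univ M" "y \<in> univ M" for F x y
    using \<phi>_eq[OF _ that] sim_iff[OF M that, of F] unfolding agree_def p_def by simp
  have sim_p: "sim C F (p x) (p y) \<longleftrightarrow> sim M F x y" if "x \<in> univ M" "y \<in> univ M" for F x y
    using agree_p[OF that] sim_C[OF pC[OF that(1)] pC[OF that(2)]] by simp
  have "inj_on p (univ M)"
  proof (rule inj_onI)
    fix x y assume xy: "x \<in> univ M" "y \<in> univ M" "p x = p y"
    then have "sim M bot x y"
      using agree_p[OF xy(1,2), of bot] by (simp add: agree_def)
    then show "x = y" using sim_bot[OF M xy(1,2)] by simp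
  qed
  moreover have "(x, y) \<in> interp M r \<longleftrightarrow> (p x, p y) \<in> interp C r"
    if xy: "x \<in> univ M" "y \<in> univ M" for r x y
  proof (cases r)
    case (Dist l)
    then show ?thesis
      using dist_iff_sim[OF M] dist_iff_sim[OF C] pC xy sim_p[OF xy] by simp
  next
    case (Ord s)
    have forward: "(p x, p y) \<in> interp C (Ord s)"
      if xy: "(x, y) \<in> interp M (Ord s)" for x y
    proof (rule ord_C)
      show s: "s \<in> S" using ord_proper[OF M xy] .
      have in_M: "x \<in> univ M" "y \<in> univ M" using ord_in[OF M xy] by auto
      show "p x \<in> univ C" "p y \<in> univ C" using in_M pC by auto
      show "agree (top_rel L s) (p x) (p y)"
        using agree_p[OF in_M] ord_sim_top[OF M xy] by simp
      show "p x s < p y s"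
        using \<phi>_less[OF s in_M] ord_imp_ext_less[OF M s xy] s by (simp add: p_def)
    qed
    \<comment> \<open>Similarity is reflected, so the order of \<open>M\<close> compares
      \<open>x\<close> and \<open>y\<close> in some direction; the reverse one would be carried
      forward and contradict asymmetry in \<open>C\<close>.\<close>
    have "(x, y) \<in> interp M (Ord s)" if pxy: "(p x, p y) \<in> interp C (Ord s)"
    proof -
      have "s \<in> order_syms L" using ord_sym[OF C pxy] .
      moreover have "sim M (top_rel L s) x y" "\<not> sim M (bot_rel L s) x y"
        using ord_sim_top[OF C pxy] ord_not_sim[OF C pxy] sim_p[OF xy] by auto
      ultimately have "(x, y) \<in> interp M (Ord s) \<or> (y, x) \<in> interp M (Ord s)"
        using ord_iff[OF M _ xy] by blast
      then show ?thesis using forward ord_asym[OF C pxy] by blast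
    qed
    then show ?thesis using forward Ord by blast
  qed
  ultimately show ?thesis
    unfolding embedding_def p_def[symmetric] using pC by blast
qed

section \<open>The partition argument\<close>

text \<open>A copy of \<open>A\<close> inside a labelled copy of \<open>B\<close> is determined by the set of labels it uses,
  so colouring copies of \<open>A\<close> amounts to colouring sets of natural numbers.\<close>

lemma lift_ramsey:
  fixes A B :: "('a::infinite, ('l, 's) symbol) struct"
  assumes A: "A \<in> lift L" and B: "B \<in> lift L"
  shows "\<exists>C\<in>lift L. \<forall>\<chi> \<in> copies C A \<rightarrow> {..<k::nat}.
    \<exists>B'\<in>copies C B. \<exists>c. \<forall>A'\<in>copies B' A. \<chi> A' = c"
proof -
  let ?WA = "S \<times> univ A" and ?WB = "S \<times> univ B"
  have fin: "finite ?WA" "finite ?WB"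
    using finite_S finite_univ[OF A] finite_univ[OF B] by (auto intro: finite_cartesian_product)
  obtain \<alpha> where \<alpha>: "represents ?WA (prec A) \<alpha>" using prec_represented[OF A] by blast
  obtain \<beta> where \<beta>: "represents ?WB (prec B) \<beta>" using prec_represented[OF B] by blast
  \<comment> \<open>Ramsey's theorem for \<open>k\<close> colours: the coloured sets have as many
    elements as \<open>A\<close> uses labels, and the homogeneous set as many as \<open>B\<close>
    uses.\<close>
  obtain N where N: "partn_lst {..<N::nat} (replicate k (card (\<beta> ` ?WB))) (card (\<alpha> ` ?WA))"
    using ramsey_full by blast
  obtain C\<^sub>0 where C\<^sub>0: "C\<^sub>0 \<in> lift L" "univ C\<^sub>0 = S \<rightarrow>\<^sub>E {..<N}"
    and sim: "\<forall>F. \<forall>x\<in>univ C\<^sub>0. \<forall>y\<in>univ C\<^sub>0. sim C\<^sub>0 F x y \<longleftrightarrow> agree F x y"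
    and ord: "\<forall>s\<in>S. \<forall>x\<in>univ C\<^sub>0. \<forall>y\<in>univ C\<^sub>0.
      agree (top_rel L s) x y \<longrightarrow> x s < y s \<longrightarrow> (x, y) \<in> interp C\<^sub>0 (Ord s)"
    using ambient_exists[of N] by (elim bexE conjE) (rule that)
  have sim_C\<^sub>0: "sim C\<^sub>0 F x y \<longleftrightarrow> agree F x y" if "x \<in> univ C\<^sub>0" "y \<in> univ C\<^sub>0" for F x y
    using sim that by blast
  have ord_C\<^sub>0: "(x, y) \<in> interp C\<^sub>0 (Ord s)"
    if "s \<in> S" "x \<in> univ C\<^sub>0" "y \<in> univ C\<^sub>0" "agree (top_rel L s) x y" "x s < y s" for s x y
    using ord that by blast
  \<comment> \<open>The ambient structure lives on functions; infinity of \<open>'a\<close> provides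
    room for an isomorphic copy \<open>C\<close>.\<close>
  obtain j :: "('s \<Rightarrow> nat) \<Rightarrow> 'a" where j: "inj_on j (univ C\<^sub>0)"
    using arb_inj_on_finite_infinite finite_univ[OF C\<^sub>0(1)] by blast
  define C where "C = \<lparr>univ = j ` univ C\<^sub>0, interp = \<lambda>r. map_prod j j ` interp C\<^sub>0 r\<rparr>"
  have C\<^sub>0_struct: "interp C\<^sub>0 r \<subseteq> univ C\<^sub>0 \<times> univ C\<^sub>0" for r
    using C\<^sub>0(1) by (simp add: lift_def is_struct_def)
  have int_C: "(j x, j y) \<in> interp C r \<longleftrightarrow> (x, y) \<in> interp C\<^sub>0 r"
    if "x \<in> univ C\<^sub>0" "y \<in> univ C\<^sub>0" for x y r
  proof
    assume "(j x, j y) \<in> interp C r"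
    then obtain u v where uv: "(u, v) \<in> interp C\<^sub>0 r" "j x = j u" "j y = j v"
      by (auto simp: C_def)
    then have "u \<in> univ C\<^sub>0" "v \<in> univ C\<^sub>0" using C\<^sub>0_struct by auto
    then show "(x, y) \<in> interp C\<^sub>0 r" using uv that j by (metis inj_onD)
  next
    assume "(x, y) \<in> interp C\<^sub>0 r"
    then show "(j x, j y) \<in> interp C r" by (auto simp: C_def)
  qed
  have iso: "struct_iso j C\<^sub>0 C"
    unfolding struct_iso_def bij_betw_def using j int_C by (simp add: C_def)
  have "map_prod j j ` interp C\<^sub>0 r \<subseteq> j ` univ C\<^sub>0 \<times> j ` univ C\<^sub>0" for r
    using C\<^sub>0_struct[of r] by auto
  then have "is_struct C" by (simp add: is_struct_def C_def)
  then have C: "C \<in> lift L" using lift_struct_iso[OF language C\<^sub>0(1) iso] by blast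
  have emb_j: "embedding j C\<^sub>0 C"
    using iso unfolding embedding_def struct_iso_def bij_betw_def by simp
  define code where "code \<phi> x = j (\<lambda>s\<in>S. \<phi> (s, x))" for \<phi> :: "'s \<times> 'a \<Rightarrow> nat" and x
  have emb_code: "embedding (code \<phi>) M C"
    if "M \<in> lift L" "represents (S \<times> univ M) (prec M) \<phi>" "\<phi> ` (S \<times> univ M) \<subseteq> {..<N}" for M \<phi>
    using embedding_comp[OF labelling_embedding[OF that(1) C\<^sub>0 sim_C\<^sub>0 ord_C\<^sub>0 that(2,3)] emb_j]
    by (simp add: comp_def code_def[abs_def])
  \<comment> \<open>Fix for each label set \<open>a\<close> of the right size a labelling of
    \<open>A\<close> onto it; \<open>cp a\<close> is the resulting copy of \<open>A\<close>.\<close>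
  have "\<forall>a\<in>nsets {..<N} (card (\<alpha> ` ?WA)). \<exists>\<phi>. represents ?WA (prec A) \<phi> \<and> \<phi> ` ?WA = a"
    using represents_onto[OF \<alpha> fin(1)] by (simp add: nsets_def)
  from bchoice[OF this] obtain \<Phi> where "\<forall>a\<in>nsets {..<N} (card (\<alpha> ` ?WA)).
      represents ?WA (prec A) (\<Phi> a) \<and> \<Phi> a ` ?WA = a" ..
  then have \<Phi>: "represents ?WA (prec A) (\<Phi> a)" "\<Phi> a ` ?WA = a"
    if "a \<in> nsets {..<N} (card (\<alpha> ` ?WA))" for a
    using that by simp_all
  define cp where "cp a = restr C (code (\<Phi> a) ` univ A)" for a
  have cp: "cp a \<in> copies C A" if a: "a \<in> nsets {..<N} (card (\<alpha> ` ?WA))" for a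
  proof -
    have "a \<subseteq> {..<N}" using a by (simp add: nsets_def)
    then have "embedding (code (\<Phi> a)) A C" using \<Phi>[OF a] by (intro emb_code[OF A]) simp_all
    then show ?thesis unfolding copies_eq_embeddings cp_def by blast
  qed
  show ?thesis
  proof (intro bexI[OF _ C] ballI)
    fix \<chi> assume "\<chi> \<in> copies C A \<rightarrow> {..<k}"
    \<comment> \<open>A label set receives the colour of its copy.\<close>
    then have "\<chi> \<circ> cp \<in> nsets {..<N} (card (\<alpha> ` ?WA)) \<rightarrow> {..<length (replicate k (card (\<beta> ` ?WB)))}"
      using cp by auto
    then obtain i where "i < k" and
      "monochromatic {..<N} (replicate k (card (\<beta> ` ?WB)) ! i) (card (\<alpha> ` ?WA)) (\<chi> \<circ> cp) i"
      using bspec[OF N[unfolded partn_lst_def]] unfolding length_replicate by blast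
    then obtain H where H: "H \<in> nsets {..<N} (card (\<beta> ` ?WB))"
      and mono: "(\<chi> \<circ> cp) ` nsets H (card (\<alpha> ` ?WA)) \<subseteq> {i}"
      unfolding monochromatic_def nth_replicate[OF \<open>i < k\<close>] by blast
    have HN: "H \<subseteq> {..<N}" "finite H" "card H = card (\<beta> ` ?WB)"
      using H by (simp_all add: nsets_def)
    obtain \<psi> where \<psi>: "represents ?WB (prec B) \<psi>" "\<psi> ` ?WB = H"
      using represents_onto[OF \<beta> fin(2) HN(2,3)] by blast
    have emb: "embedding (code \<psi>) B C"
      using \<psi> HN(1) by (intro emb_code[OF B]) simp_all
    have "\<chi> A' = i" if A': "A' \<in> copies (restr C (code \<psi> ` univ B)) A" for A'
    proof -
      obtain g where g: "embedding g A B" and A'_eq: "A' = restr C ((code \<psi> \<circ> g) ` univ A)"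
        using copies_of_copy[OF emb A'] .
      have gB: "g x \<in> univ B" if "x \<in> univ A" for x
        using g that unfolding embedding_def by blast
      \<comment> \<open>The labelling that \<open>A\<close> inherits from \<open>B\<close> through
        \<open>g\<close>. Its labels lie in \<open>H\<close>, and their number is right because all
        labellings of \<open>A\<close> use equally many.\<close>
      define \<theta> where "\<theta> = (\<lambda>(s, x). \<psi> (s, g x))"
      have \<theta>: "represents ?WA (prec A) \<theta>"
        unfolding \<theta>_def using embedding_represents[OF g \<psi>(1)] .
      have "\<theta> ` ?WA \<subseteq> H"
        using gB unfolding \<theta>_def \<psi>(2)[symmetric] by auto
      then have a: "\<theta> ` ?WA \<in> nsets H (card (\<alpha> ` ?WA))"
        using represents_card[OF \<theta> \<alpha>] fin(1) by (simp add: nsets_def)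
      then have aN: "\<theta> ` ?WA \<in> nsets {..<N} (card (\<alpha> ` ?WA))"
        using HN(1) nsets_mono by blast
      \<comment> \<open>Uniqueness identifies the inherited labelling with the fixed one, so
        \<open>A'\<close> is the copy \<open>cp\<close> of a subset of \<open>H\<close>.\<close>
      have "\<Phi> (\<theta> ` ?WA) w = \<theta> w" if "w \<in> ?WA" for w
        using \<Phi>[OF aN] \<theta> fin(1) that by (intro represents_unique) auto
      then have "code (\<Phi> (\<theta> ` ?WA)) x = (code \<psi> \<circ> g) x" if "x \<in> univ A" for x
        using that unfolding code_def \<theta>_def by (simp cong: restrict_cong)
      then have "A' = cp (\<theta> ` ?WA)"
        unfolding A'_eq cp_def by (metis (no_types, lifting) image_cong)
      then show ?thesis using mono a by auto
    qed
    moreover have "restr C (code \<psi> ` univ B) \<in> copies C B"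
      unfolding copies_eq_embeddings using emb by blast
    ultimately show "\<exists>B'\<in>copies C B. \<exists>c. \<forall>A'\<in>copies B' A. \<chi> A' = c" by blast
  qed
qed

end

theorem mainTheorem2:
  fixes L :: "('l::{finite, distrib_lattice, bounded_lattice}, 's) language"
  assumes "well_equipped L"
  shows "ramsey_class (lift L :: ('a::infinite, ('l, 's) symbol) struct set)"
proof -
  have lang: "is_language L" using assms by (simp add: well_equipped_def)
  then have "finite (proper L)" by (simp add: is_language_def)
  \<comment> \<open>Any such ranking will do; it is \<open>exists_ranking\<close> for
    \<open>bot_rel L\<close>.\<close>
  then obtain \<iota> :: "'s \<Rightarrow> nat" where \<iota>: "inj_on \<iota> (proper L)"
    "\<forall>s\<in>proper L. \<forall>t\<in>proper L. bot_rel L s < bot_rel L t \<longrightarrow> \<iota> t < \<iota> s"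
    using exists_ranking by blast
  interpret ranked_language L \<iota>
  proof (rule ranked_language.intro[OF assms \<iota>(1)])
    show "\<iota> t < \<iota> s" if "s \<in> proper L" "t \<in> proper L" "bot_rel L s < bot_rel L t" for s t
      using \<iota>(2) that by simp
  qed
  show ?thesis
    unfolding ramsey_class_def
  proof (intro conjI ballI allI impI)
    fix A :: "('a, ('l, 's) symbol) struct" assume A: "A \<in> lift L"
    then show "is_struct A" "finite (univ A)" by (simp_all add: lift_def)
    show "B \<in> lift L" if "is_struct B \<and> isomorphic A B" for B :: "('a, ('l, 's) symbol) struct"
      using that A lift_struct_iso[OF lang] unfolding isomorphic_def by blast
  qed (rule lift_ramsey)
qed

end
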